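(* Let $M,R_x\ge0$ be real numbers and let $(f,x_0)$ be a $(\mathcal C_M,R_x)$-input. 1. For any $N\in\mathbb N$, $$f(\mathrm{GFOM}_N(f,x_0))-f_*\le\frac{MR_x}{\sqrt{N+1}}.$$ Furthermore, this bound is tight when $d\ge 2N+2$. 2. (With $M>0$.) For any $N\in\mathbb N$ and any sequence $x_1,\dots,x_N$ that satisfies, with $f'(x_i)\in\partial f(x_i)$ for $0\le i\le N$, $$\Big\langle f'(x_i),\ x_i-\Big[\frac{i}{i+1}x_{i-1}+\frac1{i+1}x_0-\frac1{i+1}\frac{R_x}{M\sqrt{N+1}}\sum_{j=0}^{i-1}f'(x_j)\Big]\Big\rangle=0,\qquad i=1,\dots,N,$$ we have $$f(x_N)-f_*\le\frac{MR_x}{\sqrt{N+1}}.$$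
   Context: $\langle\cdot,\cdot\rangle$, $\|\cdot\|$ are the Euclidean inner product and norm on $\mathbb R^d$; $\mathbb N$ denotes the positive integers; $f_*:=\min f$. $\mathcal C_M=\mathcal C_M(\mathbb R^d)$ is the class of (Lipschitz) closed, convex and proper functions $f$ on $\mathbb R^d$ such that $\|g\|\le M$ for all $x\in\mathbb R^d$ and all $g\in\partial f(x)$. $(f,x_0)$ is a $(\mathcal C_M,R_x)$-input if $f\in\mathcal C_M(\mathbb R^d)$, $x_0\in\mathbb R^d$ and $\|x_0-x_*\|\le R_x$ for some $x_*\in\operatorname{argmin}f$. GFOM (greedy first-order method): a run on $(f,x_0)$ with $N$ iterations consists of points $x_1,\dots,x_N$ and subgradients $f'(x_i)\in\partial f(x_i)$, $0\le i\le N$, such that for $i=1,\dots,N$: $x_i\in\operatorname{argmin}\{f(x): x\in x_0+\mathrm{span}\{f'(x_0),\dots,f'(x_{i-1})\}\}$ and $\langle f'(x_i),f'(x_j)\rangle=0$ for all $0\le j<i$. Its output is $\mathrm{GFOM}_N(f,x_0):=x_N$; if the minimum over one of the subspaces is not attained, there is no output. The bound is claimed for every output. "The bound is tight" means: for every $\varepsilon>0$ there is a $(\mathcal C_M(\mathbb R^d),R_x)$-input $(\hat f,\hat x_0)$ and an output of GFOM on it such that $\hat f(\mathrm{GFOM}_N(\hat f,\hat x_0))-\hat f_*\ge\frac{MR_x}{\sqrt{N+1}}-\varepsilon$. *)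

theory Defs
  imports "HOL-Analysis.Analysis"
begin

definition epi :: "('a \<Rightarrow> ereal) \<Rightarrow> ('a \<times> real) set" where
  "epi f = {(x, r). f x \<le> ereal r}"

definition proper_fun :: "('a \<Rightarrow> ereal) \<Rightarrow> bool" where
  "proper_fun f \<longleftrightarrow> (\<exists>x. f x < \<infinity>) \<and> (\<forall>x. f x \<noteq> -\<infinity>)"

definition closed_fun :: "('a::topological_space \<Rightarrow> ereal) \<Rightarrow> bool" where
  "closed_fun f \<longleftrightarrow> closed (epi f)"

definition convex_fun :: "('a::real_vector \<Rightarrow> ereal) \<Rightarrow> bool" where
  "convex_fun f \<longleftrightarrow> convex (epi f)"

(* For proper f the set is empty wherever f is infinite, so no separate domain condition
   is needed. *)
definition subdifferential :: "('a::real_inner \<Rightarrow> ereal) \<Rightarrow> 'a \<Rightarrow> 'a set" where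
  "subdifferential f x = {g. \<forall>y. f x + ereal (g \<bullet> (y - x)) \<le> f y}"

(* Lipschitz continuity (and hence finiteness) of the members is a consequence of the bound
   on the subgradients, not an additional requirement. *)
definition class_C :: "real \<Rightarrow> ('a::euclidean_space \<Rightarrow> ereal) set" where
  "class_C M = {f. closed_fun f \<and> convex_fun f \<and> proper_fun f \<and>
                   (\<forall>x. \<forall>g\<in>subdifferential f x. norm g \<le> M)}"

definition is_input :: "real \<Rightarrow> real \<Rightarrow> ('a::euclidean_space \<Rightarrow> ereal) \<Rightarrow> 'a \<Rightarrow> bool" where
  "is_input M R f x0 \<longleftrightarrow>
     f \<in> class_C M \<and> (\<exists>xs. is_arg_min f (\<lambda>_. True) xs \<and> norm (x0 - xs) \<le> R)"

(* The infimum is a minimum for every function occurring in an input. *)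
definition min_val :: "('a \<Rightarrow> ereal) \<Rightarrow> ereal" where
  "min_val f = (INF x. f x)"

(* g i is the subgradient selected at x i. The selection is made per index, so g may take
   different values at iterates that coincide. *)
definition gfom_run ::
  "nat \<Rightarrow> ('a::euclidean_space \<Rightarrow> ereal) \<Rightarrow> 'a \<Rightarrow> (nat \<Rightarrow> 'a) \<Rightarrow> (nat \<Rightarrow> 'a) \<Rightarrow> bool" where
  "gfom_run N f x0 x g \<longleftrightarrow>
     x 0 = x0 \<and>
     (\<forall>i\<le>N. g i \<in> subdifferential f (x i)) \<and>
     (\<forall>i\<in>{1..N}.
        is_arg_min f (\<lambda>z. z \<in> (\<lambda>v. x0 + v) ` span (g ` {0..<i})) (x i) \<and>
        (\<forall>j<i. g i \<bullet> g j = 0))"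

(* The set of all possible outputs; it is empty if no run exists. *)
definition GFOM :: "nat \<Rightarrow> ('a::euclidean_space \<Rightarrow> ereal) \<Rightarrow> 'a \<Rightarrow> 'a set" where
  "GFOM N f x0 = {x N | x g. gfom_run N f x0 x g}"

end

theory Submission
  imports Defs
begin

text \<open>
  Both upper bounds come from adding up finitely many subgradient inequalities, so they use
  the function only at the iterates and at a minimizer \<open>xs\<close>.

  For the greedy method the inequality at \<open>x i\<close> against \<open>xs\<close> reads
  \<open>f (x i) - f xs \<le> g i \<bullet> (x i - xs)\<close>. Since \<open>g i\<close> is orthogonal to the earlier
  subgradients, whose span contains \<open>x i - x0\<close>, the right-hand side is \<open>g i \<bullet> (x0 - xs)\<close>.
  The last iterate has the smallest value, so summing over the \<open>N + 1\<close> iterates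
  bounds \<open>(N + 1) (f (x N) - f xs)\<close> by \<open>norm (\<Sum>i\<le>N. g i) * R\<close>, and by Pythagoras the norm is at
  most \<open>sqrt (N + 1) * M\<close> (lemma \<open>orthogonal_subgradients_bound\<close>).

  For the second family there is no monotonicity. It is replaced by the inequalities between
  consecutive iterates, taken with weight \<open>i\<close>: the values telescope to the same left-hand side
  \<open>(N + 1) (f (x N) - f xs)\<close>. The condition on \<open>x i\<close> is exactly what turns the right-hand side
  into \<open>S \<bullet> (x0 - xs)\<close> minus a step size times \<open>\<Sum>i\<le>N. g i \<bullet> (\<Sum>j<i. g j)\<close>, where \<open>S\<close> is the sum
  of the subgradients. The latter sum is
  half the difference of \<open>(norm S)\<^sup>2\<close> and \<open>\<Sum>i\<le>N. (norm (g i))\<^sup>2\<close>, and the step size is the one for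
  which completing the square in \<open>norm S\<close> gives the bound
  (lemma \<open>averaging_condition_bound\<close>).

  The bound is attained by the piecewise linear function
  \<open>x \<mapsto> max (max\<^sub>i M (b i \<bullet> x)) (- M R / sqrt (N + 1))\<close> with \<open>N + 1\<close> orthonormal vectors \<open>b i\<close>, started at
  the origin: at the origin every \<open>M b i\<close> is a subgradient, and after any \<open>i \<le> N\<close>
  of them have been revealed the function is still nonnegative on their span, because the
  piece belonging to the next vector vanishes there. The method may therefore stay at the origin, where the value is \<open>0\<close>.
\<close>

section \<open>Subgradient inequalities at finite values\<close>

lemma input_minimizer:
  assumes "is_input M R f x0"
  obtains xs fs where "f xs = ereal fs" "min_val f = ereal fs" "norm (x0 - xs) \<le> R"
proof -
  from assms obtain xs where xs: "\<And>y. f xs \<le> f y" "norm (x0 - xs) \<le> R" and pr: "proper_fun f"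
    unfolding is_input_def class_C_def is_arg_min_def by (auto simp: not_less)
  from pr obtain y where "f y < \<infinity>" unfolding proper_fun_def by blast
  with xs(1)[of y] have "f xs < \<infinity>" by (rule le_less_trans)
  moreover have "f xs \<noteq> -\<infinity>" using pr unfolding proper_fun_def by blast
  ultimately obtain fs where fs: "f xs = ereal fs" by (cases "f xs") auto
  have "min_val f = f xs" unfolding min_val_def
    by (rule antisym) (auto intro: INF_lower INF_greatest xs(1))
  with fs xs(2) that show thesis by simp
qed

lemma subgradient_at_finite_value:
  assumes "proper_fun f" "g \<in> subdifferential f x" "f y = ereal fy"
  obtains r where "f x = ereal r" "r + g \<bullet> (y - x) \<le> fy"
proof -
  have "f x + ereal (g \<bullet> (y - x)) \<le> f y"
    using assms(2) unfolding subdifferential_def by blast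
  then have "f x + ereal (g \<bullet> (y - x)) \<le> ereal fy" by (simp only: assms(3))
  moreover have "f x \<noteq> -\<infinity>" using assms(1) unfolding proper_fun_def by blast
  ultimately show thesis using that by (cases "f x") auto
qed

text \<open>All that the two upper bounds need to know about \<open>f\<close>: real function values at the iterates, the
  subgradient inequalities among them and against a minimizer, and the bound on the subgradients.\<close>

lemma input_interpolation:
  fixes f :: "'a::euclidean_space \<Rightarrow> ereal"
  assumes inp: "is_input M R f x0" and g: "\<forall>i\<le>N. g i \<in> subdifferential f (x i)"
  obtains xs fs \<phi> where
    "min_val f = ereal fs" "norm (x0 - xs) \<le> R"
    "\<And>i. i \<le> N \<Longrightarrow> f (x i) = ereal (\<phi> i)"
    "\<And>i. i \<le> N \<Longrightarrow> norm (g i) \<le> M"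
    "\<And>i. i \<le> N \<Longrightarrow> \<phi> i - fs \<le> g i \<bullet> (x i - xs)"
    "\<And>i j. i \<le> N \<Longrightarrow> j \<le> N \<Longrightarrow> \<phi> i - \<phi> j \<le> g i \<bullet> (x i - x j)"
proof -
  obtain xs fs where xs: "f xs = ereal fs" "min_val f = ereal fs" "norm (x0 - xs) \<le> R"
    using input_minimizer[OF inp] .
  have pr: "proper_fun f" and bd: "\<And>y h. h \<in> subdifferential f y \<Longrightarrow> norm h \<le> M"
    using inp unfolding is_input_def class_C_def by auto
  define \<phi> where "\<phi> i = real_of_ereal (f (x i))" for i
  have fin: "f (x i) = ereal (\<phi> i)" if "i \<le> N" for i
    using subgradient_at_finite_value[OF pr g[rule_format, OF that] xs(1)]
    unfolding \<phi>_def by (metis real_of_ereal.simps(1))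
  have ineq: "\<phi> i - r \<le> g i \<bullet> (x i - y)" if i: "i \<le> N" and y: "f y = ereal r" for i y r
  proof -
    obtain s where s: "f (x i) = ereal s" "s + g i \<bullet> (y - x i) \<le> r"
      using subgradient_at_finite_value[OF pr g[rule_format, OF i] y] .
    from s(1) fin[OF i] have "s = \<phi> i" by simp
    with s(2) show ?thesis by (simp add: inner_diff_right)
  qed
  show thesis
  proof (rule that)
    show "min_val f = ereal fs" "norm (x0 - xs) \<le> R" by fact+
    show "f (x i) = ereal (\<phi> i)" if "i \<le> N" for i using fin that .
    show "norm (g i) \<le> M" if "i \<le> N" for i using g that bd by blast
    show "\<phi> i - fs \<le> g i \<bullet> (x i - xs)" if "i \<le> N" for i using ineq that xs(1) .
    show "\<phi> i - \<phi> j \<le> g i \<bullet> (x i - x j)" if "i \<le> N" "j \<le> N" for i j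
      using ineq[OF that(1) fin[OF that(2)]] .
  qed
qed

section \<open>The upper bound for the greedy method\<close>

text \<open>Pythagoras is used for its gain of \<open>sqrt (N + 1)\<close> over the triangle inequality.\<close>

lemma orthogonal_subgradients_bound:
  fixes g x :: "nat \<Rightarrow> 'a::real_inner"
  assumes M: "M \<ge> 0" and xs: "norm (x0 - xs) \<le> R"
    and gM: "\<And>i. i \<le> N \<Longrightarrow> norm (g i) \<le> M"
    and opt: "\<And>i. i \<le> N \<Longrightarrow> \<phi> i - fs \<le> g i \<bullet> (x i - xs)"
    and last: "\<And>i. i \<le> N \<Longrightarrow> \<phi> N \<le> \<phi> i"
    and orth: "\<And>i j. i \<le> N \<Longrightarrow> j < i \<Longrightarrow> g i \<bullet> g j = 0"
    and orth0: "\<And>i. i \<le> N \<Longrightarrow> g i \<bullet> (x i - x0) = 0"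
  shows "\<phi> N - fs \<le> M * R / sqrt (real N + 1)"
proof -
  define q where "q = sqrt (real N + 1)"
  have q: "q > 0" "q\<^sup>2 = real N + 1" unfolding q_def by auto
  let ?S = "\<Sum>i\<le>N. g i"
  have "pairwise (\<lambda>i j. orthogonal (g i) (g j)) {..N}"
    unfolding pairwise_def orthogonal_def
    by (metis atMost_iff inner_commute linorder_neqE_nat orth)
  then have "(norm ?S)\<^sup>2 = (\<Sum>i\<le>N. (norm (g i))\<^sup>2)"
    by (intro norm_sum_Pythagorean) auto
  also have "\<dots> \<le> (\<Sum>i\<le>N. M\<^sup>2)"
    by (intro sum_mono power_mono) (auto simp: gM)
  also have "\<dots> = (q * M)\<^sup>2" by (simp add: power_mult_distrib q(2) add.commute)
  finally have S: "norm ?S \<le> q * M" by (rule power2_le_imp_le) (use M q in simp)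
  have "q\<^sup>2 * (\<phi> N - fs) = (\<Sum>i\<le>N. \<phi> N - fs)" by (simp add: q(2) add.commute)
  also have "\<dots> \<le> (\<Sum>i\<le>N. g i \<bullet> (x0 - xs))"
  proof (rule sum_mono)
    fix i assume "i \<in> {..N}"
    then show "\<phi> N - fs \<le> g i \<bullet> (x0 - xs)"
      using opt[of i] last[of i] orth0[of i] by (simp add: inner_diff_right)
  qed
  also have "\<dots> = ?S \<bullet> (x0 - xs)" by (simp add: inner_sum_left)
  also have "\<dots> \<le> norm ?S * norm (x0 - xs)" by (rule norm_cauchy_schwarz)
  also have "\<dots> \<le> (q * M) * R" using S xs M q by (intro mult_mono) auto
  finally have "q * (\<phi> N - fs) \<le> M * R" using q(1) by (simp add: power2_eq_square mult.assoc)
  then have "\<phi> N - fs \<le> M * R / q" using q(1) by (simp add: field_simps)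
  then show ?thesis unfolding q_def .
qed

lemma gfom_upper_bound:
  fixes f :: "'a::euclidean_space \<Rightarrow> ereal"
  assumes M: "M \<ge> 0" and inp: "is_input M R f x0" and y: "y \<in> GFOM N f x0"
  shows "f y - min_val f \<le> ereal (M * R / sqrt (real N + 1))"
proof -
  from y obtain x g where yx: "y = x N" and run: "gfom_run N f x0 x g"
    unfolding GFOM_def by blast
  have x0: "x 0 = x0" and g: "\<forall>i\<le>N. g i \<in> subdifferential f (x i)"
    and am: "\<And>i. i \<in> {1..N} \<Longrightarrow> is_arg_min f (\<lambda>z. z \<in> (+) x0 ` span (g ` {0..<i})) (x i)"
    and or: "\<And>i j. i \<in> {1..N} \<Longrightarrow> j < i \<Longrightarrow> g i \<bullet> g j = 0"
    using run unfolding gfom_run_def by auto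
  obtain xs fs \<phi> where I: "min_val f = ereal fs" "norm (x0 - xs) \<le> R"
    "\<And>i. i \<le> N \<Longrightarrow> f (x i) = ereal (\<phi> i)"
    "\<And>i. i \<le> N \<Longrightarrow> norm (g i) \<le> M"
    "\<And>i. i \<le> N \<Longrightarrow> \<phi> i - fs \<le> g i \<bullet> (x i - xs)"
    using input_interpolation[OF inp g] by metis
  have orth: "g i \<bullet> g j = 0" if "i \<le> N" "j < i" for i j
    using or that by simp
  have spn: "x i - x0 \<in> span (g ` {0..<i})" if "i \<le> N" for i
  proof (cases "i = 0")
    case True then show ?thesis by (simp add: x0)
  next
    case False
    then show ?thesis using am[of i] that by (auto simp: is_arg_min_def)
  qed
  have "\<phi> N - fs \<le> M * R / sqrt (real N + 1)"
  proof (rule orthogonal_subgradients_bound[OF M I(2,4,5) _ orth])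
    fix i assume i: "i \<le> N"
    have "orthogonal (g i) (x i - x0)"
      by (rule orthogonal_to_span[OF spn[OF i]]) (use orth i in \<open>auto simp: orthogonal_def\<close>)
    then show "g i \<bullet> (x i - x0) = 0" by (simp add: orthogonal_def)
    show "\<phi> N \<le> \<phi> i"
    proof (cases "i = N")
      case False
      have "x i - x0 \<in> span (g ` {0..<N})"
        using spn[OF i] span_mono[of "g ` {0..<i}" "g ` {0..<N}"] i by fastforce
      then have "x i \<in> (+) x0 ` span (g ` {0..<N})"
        by (intro image_eqI[of _ _ "x i - x0"]) auto
      then have "f (x N) \<le> f (x i)"
        using am[of N] False i by (auto simp: is_arg_min_def not_less)
      then show ?thesis using I(3)[OF i] I(3)[of N] by simp
    qed simp
  qed
  then show ?thesis using I(1) I(3)[of N] by (simp add: yx)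
qed

section \<open>The upper bound under the averaging condition\<close>

lemma weighted_telescoping:
  fixes \<phi> :: "nat \<Rightarrow> real"
  shows "(\<Sum>i\<le>n. (\<phi> i - c) + real i * (\<phi> i - \<phi> (i - 1))) = (real n + 1) * (\<phi> n - c)"
  by (induction n) (simp_all add: algebra_simps)

lemma norm_sum_square_expansion:
  fixes g :: "nat \<Rightarrow> 'a::real_inner"
  shows "(norm (\<Sum>i\<le>n. g i))\<^sup>2 = (\<Sum>i\<le>n. (norm (g i))\<^sup>2) + 2 * (\<Sum>i\<le>n. g i \<bullet> (\<Sum>j<i. g j))"
proof (induction n)
  case (Suc n)
  then show ?case
    by (simp add: power2_norm_eq_inner inner_add_left inner_add_right inner_commute lessThan_Suc_atMost
        algebra_simps)
qed (simp add: power2_norm_eq_inner)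

text \<open>The averaging condition appears with its denominators cleared, because in this form it cancels
  against the weight \<open>i\<close> of the inequality between \<open>x i\<close> and \<open>x (i - 1)\<close>. At \<open>i = 0\<close> it only says
  that \<open>g 0\<close> is orthogonal to \<open>x 0 - x0\<close>.\<close>

lemma averaging_condition_bound:
  fixes g x :: "nat \<Rightarrow> 'a::real_inner"
  assumes M: "M > 0" and R: "R \<ge> 0" and xs: "norm (x0 - xs) \<le> R"
    and gM: "\<And>i. i \<le> N \<Longrightarrow> norm (g i) \<le> M"
    and opt: "\<And>i. i \<le> N \<Longrightarrow> \<phi> i - fs \<le> g i \<bullet> (x i - xs)"
    and step: "\<And>i j. i \<le> N \<Longrightarrow> j \<le> N \<Longrightarrow> \<phi> i - \<phi> j \<le> g i \<bullet> (x i - x j)"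
    and avg: "\<And>i. i \<le> N \<Longrightarrow> real i * (g i \<bullet> (x i - x (i - 1))) + g i \<bullet> (x i - x0)
                + R / (M * sqrt (real N + 1)) * (g i \<bullet> (\<Sum>j<i. g j)) = 0"
  shows "\<phi> N - fs \<le> M * R / sqrt (real N + 1)"
proof -
  define q where "q = sqrt (real N + 1)"
  have q: "q > 0" "q\<^sup>2 = real N + 1" unfolding q_def by auto
  define h where "h = R / (M * q)"
  have h: "h \<ge> 0" and R_eq: "R = h * M * q" using M R q unfolding h_def by auto
  let ?S = "\<Sum>i\<le>N. g i"
  let ?C = "\<Sum>i\<le>N. g i \<bullet> (\<Sum>j<i. g j)"
  have "q\<^sup>2 * (\<phi> N - fs) = (\<Sum>i\<le>N. (\<phi> i - fs) + real i * (\<phi> i - \<phi> (i - 1)))"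
    unfolding weighted_telescoping q(2) ..
  also have "\<dots> \<le> (\<Sum>i\<le>N. g i \<bullet> (x0 - xs) - h * (g i \<bullet> (\<Sum>j<i. g j)))"
  proof (rule sum_mono)
    fix i assume "i \<in> {..N}"
    then have i: "i \<le> N" by simp
    have "real i * (\<phi> i - \<phi> (i - 1)) \<le> real i * (g i \<bullet> (x i - x (i - 1)))"
      using step[OF i, of "i - 1"] i by (intro mult_left_mono) auto
    moreover note opt[OF i] avg[OF i, folded q_def, folded h_def]
    moreover have "g i \<bullet> (x0 - xs) = g i \<bullet> (x i - xs) - g i \<bullet> (x i - x0)"
      by (simp add: inner_diff_right)
    ultimately show "(\<phi> i - fs) + real i * (\<phi> i - \<phi> (i - 1))
        \<le> g i \<bullet> (x0 - xs) - h * (g i \<bullet> (\<Sum>j<i. g j))" by linarith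
  qed
  also have "\<dots> = ?S \<bullet> (x0 - xs) - h * ?C"
    by (simp add: inner_sum_left sum_subtractf sum_distrib_left)
  also have "\<dots> \<le> h * M * q * norm ?S - h * ?C"
  proof -
    have "?S \<bullet> (x0 - xs) \<le> norm ?S * norm (x0 - xs)" by (rule norm_cauchy_schwarz)
    also have "\<dots> \<le> norm ?S * R" using xs by (intro mult_left_mono) auto
    finally show ?thesis unfolding R_eq by (simp add: mult.commute)
  qed
  also have "\<dots> \<le> h * (M\<^sup>2 * q\<^sup>2)"
  proof -
    have "(\<Sum>i\<le>N. (norm (g i))\<^sup>2) \<le> (\<Sum>i\<le>N. M\<^sup>2)"
      by (intro sum_mono power_mono) (auto simp: gM)
    then have "(norm ?S)\<^sup>2 - 2 * ?C \<le> M\<^sup>2 * q\<^sup>2"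
      by (simp add: norm_sum_square_expansion q(2) algebra_simps)
    moreover have "0 \<le> (norm ?S - M * q)\<^sup>2" by simp
    \<comment> \<open>The factor \<open>M * q\<close> is where the square is completed: it is the largest norm that \<open>S\<close> can
      have when the subgradients are orthogonal.\<close>
    ultimately have "M * q * norm ?S - ?C \<le> M\<^sup>2 * q\<^sup>2"
      by (simp add: power2_eq_square algebra_simps)
    from mult_left_mono[OF this h] show ?thesis by (simp add: algebra_simps)
  qed
  also have "\<dots> = q * (M * R)" by (simp add: R_eq power2_eq_square)
  finally have "q * (\<phi> N - fs) \<le> M * R" using q(1) by (simp add: power2_eq_square mult.assoc)
  then have "\<phi> N - fs \<le> M * R / q" using q(1) by (simp add: field_simps)
  then show ?thesis unfolding q_def .
qed

lemma averaging_upper_bound: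
  fixes f :: "'a::euclidean_space \<Rightarrow> ereal"
  assumes M: "M > 0" and R: "R \<ge> 0" and inp: "is_input M R f x0"
    and x0: "x 0 = x0" and g: "\<forall>i\<le>N. g i \<in> subdifferential f (x i)"
    and avg: "\<forall>i\<in>{1..N}. g i \<bullet> (x i -
                   ((real i / (real i + 1)) *\<^sub>R x (i - 1)
                    + (1 / (real i + 1)) *\<^sub>R x0
                    - ((1 / (real i + 1)) * (R / (M * sqrt (real N + 1)))) *\<^sub>R (\<Sum>j=0..i-1. g j))) = 0"
  shows "f (x N) - min_val f \<le> ereal (M * R / sqrt (real N + 1))"
proof -
  obtain xs fs \<phi> where I: "min_val f = ereal fs" "norm (x0 - xs) \<le> R"
    "\<And>i. i \<le> N \<Longrightarrow> f (x i) = ereal (\<phi> i)"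
    "\<And>i. i \<le> N \<Longrightarrow> norm (g i) \<le> M"
    "\<And>i. i \<le> N \<Longrightarrow> \<phi> i - fs \<le> g i \<bullet> (x i - xs)"
    "\<And>i j. i \<le> N \<Longrightarrow> j \<le> N \<Longrightarrow> \<phi> i - \<phi> j \<le> g i \<bullet> (x i - x j)"
    using input_interpolation[OF inp g] by metis
  define h where "h = R / (M * sqrt (real N + 1))"
  have avg': "real i * (g i \<bullet> (x i - x (i - 1))) + g i \<bullet> (x i - x0) + h * (g i \<bullet> (\<Sum>j<i. g j)) = 0"
    if i: "i \<le> N" for i
  proof (cases "i = 0")
    case True then show ?thesis by (simp add: x0)
  next
    case False
    define k where "k = real i + 1"
    have k: "k \<noteq> 0" unfolding k_def by auto
    have "{0..i-1} = {..<i}" using False by auto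
    with False i avg have "g i \<bullet> (x i - ((real i / k) *\<^sub>R x (i - 1) + (1 / k) *\<^sub>R x0
        - ((1 / k) * h) *\<^sub>R (\<Sum>j<i. g j))) = 0"
      unfolding k_def h_def by (metis One_nat_def Suc_leI atLeastAtMost_iff not_gr_zero)
    then have "g i \<bullet> x i - ((real i / k) * (g i \<bullet> x (i - 1)) + (1 / k) * (g i \<bullet> x0)
        - ((1 / k) * h) * (g i \<bullet> (\<Sum>j<i. g j))) = 0"
      by (simp only: inner_diff_right inner_add_right inner_scaleR_right)
    then have "k * (g i \<bullet> x i - ((real i / k) * (g i \<bullet> x (i - 1)) + (1 / k) * (g i \<bullet> x0)
        - ((1 / k) * h) * (g i \<bullet> (\<Sum>j<i. g j)))) = 0" by simp
    then have "k * (g i \<bullet> x i) - real i * (g i \<bullet> x (i - 1)) - g i \<bullet> x0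
        + h * (g i \<bullet> (\<Sum>j<i. g j)) = 0"
      using k by (simp add: right_diff_distrib distrib_left)
    then show ?thesis unfolding k_def by (simp add: inner_diff_right algebra_simps)
  qed
  have "\<phi> N - fs \<le> M * R / sqrt (real N + 1)"
    by (rule averaging_condition_bound[of M R x0 xs N g \<phi> fs x])
      (use M R I avg'[unfolded h_def] in auto)
  then show ?thesis using I(1) I(3)[of N] by simp
qed

section \<open>A function attaining the bound\<close>

text \<open>Truncating at \<open>- c\<close> makes the maximum of the linear functions \<open>M * (b i \<bullet> x)\<close> bounded below.\<close>

definition truncated_max :: "real \<Rightarrow> nat \<Rightarrow> (nat \<Rightarrow> 'a::euclidean_space) \<Rightarrow> real \<Rightarrow> 'a \<Rightarrow> real" where
  "truncated_max M N b c x = Max (insert (- c) ((\<lambda>i. M * (b i \<bullet> x)) ` {..N}))"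

lemma truncated_max_le_iff:
  "truncated_max M N b c x \<le> r \<longleftrightarrow> - c \<le> r \<and> (\<forall>i\<le>N. M * (b i \<bullet> x) \<le> r)"
  unfolding truncated_max_def by (subst Max_le_iff) auto

lemma truncated_max_ge:
  "- c \<le> truncated_max M N b c x" "i \<le> N \<Longrightarrow> M * (b i \<bullet> x) \<le> truncated_max M N b c x"
  using truncated_max_le_iff[of M N b c x "truncated_max M N b c x"] by auto

text \<open>The epigraph is an intersection of closed half-spaces, and the function is \<open>M\<close>-Lipschitz because each piece
  is. Evaluating the subgradient inequality one step along the subgradient turns the Lipschitz
  bound into the norm bound.\<close>

lemma truncated_max_in_class:
  fixes b :: "nat \<Rightarrow> 'a::euclidean_space"
  assumes M: "M \<ge> 0" and b: "\<And>i. i \<le> N \<Longrightarrow> norm (b i) = 1"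
  shows "(\<lambda>x. ereal (truncated_max M N b c x)) \<in> class_C M"
proof -
  let ?\<phi> = "truncated_max M N b c"
  let ?f = "\<lambda>x. ereal (?\<phi> x)"
  have epi: "epi ?f = {z. (0, -1) \<bullet> z \<le> c} \<inter> (\<Inter>i\<in>{..N}. {z. (M *\<^sub>R b i, -1) \<bullet> z \<le> 0})"
    unfolding epi_def by (auto simp: truncated_max_le_iff inner_Pair)
  have "closed_fun ?f" unfolding closed_fun_def epi
    by (intro closed_Int closed_INT ballI closed_halfspace_le)
  moreover have "convex_fun ?f" unfolding convex_fun_def epi
    by (intro convex_Int convex_INT convex_halfspace_le)
  moreover have "proper_fun ?f" unfolding proper_fun_def by simp
  moreover have "norm g \<le> M" if "g \<in> subdifferential ?f x" for g x
  proof -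
    have "?f x + ereal (g \<bullet> (x + g - x)) \<le> ?f (x + g)"
      using that unfolding subdifferential_def by blast
    then have "?\<phi> x + norm g * norm g \<le> ?\<phi> (x + g)"
      by (simp add: power2_norm_eq_inner[symmetric] power2_eq_square)
    also have "?\<phi> (x + g) \<le> ?\<phi> x + M * norm g"
      unfolding truncated_max_le_iff
    proof (intro conjI allI impI)
      show "- c \<le> ?\<phi> x + M * norm g"
        using truncated_max_ge(1)[of c M N b x] M by (simp add: add_increasing2)
      fix i assume i: "i \<le> N"
      have "b i \<bullet> g \<le> norm g" using norm_cauchy_schwarz[of "b i" g] b[OF i] by simp
      then have "M * (b i \<bullet> g) \<le> M * norm g" using M by (rule mult_left_mono)
      then show "M * (b i \<bullet> (x + g)) \<le> ?\<phi> x + M * norm g"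
        using truncated_max_ge(2)[OF i, of M b x c] by (simp add: inner_add_right distrib_left)
    qed
    finally have "norm g * norm g \<le> M * norm g" by simp
    then show ?thesis using M by (cases "g = 0") auto
  qed
  ultimately show ?thesis unfolding class_C_def by blast
qed

lemma obtain_orthonormal_sequence:
  assumes "n < DIM('a::euclidean_space)"
  obtains b :: "nat \<Rightarrow> 'a::euclidean_space" where
    "\<And>i. i \<le> n \<Longrightarrow> norm (b i) = 1" "\<And>i j. i \<le> n \<Longrightarrow> j \<le> n \<Longrightarrow> i \<noteq> j \<Longrightarrow> b i \<bullet> b j = 0"
proof -
  have "card {..n} \<le> card (Basis :: 'a set)" using assms by simp
  then obtain b :: "nat \<Rightarrow> 'a" where b: "b ` {..n} \<subseteq> Basis" "inj_on b {..n}"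
    using card_le_inj[of "{..n}" "Basis :: 'a set"] by auto
  show thesis
  proof (rule that)
    show "norm (b i) = 1" if "i \<le> n" for i using b(1) that by (auto intro: norm_Basis)
    show "b i \<bullet> b j = 0" if "i \<le> n" "j \<le> n" "i \<noteq> j" for i j
      using b that by (intro inner_not_same_Basis) (auto dest: inj_onD)
  qed
qed

text \<open>The level of truncation is the value of the untruncated maximum at the point of norm \<open>R\<close> on the
  negative diagonal, which makes that point a minimizer.\<close>

lemma gfom_bound_attained:
  assumes M: "M \<ge> 0" and R: "R \<ge> 0" and dim: "N < DIM('a::euclidean_space)"
  shows "\<exists>(f :: 'a::euclidean_space \<Rightarrow> ereal) x0. is_input M R f x0 \<and>
           (\<exists>y\<in>GFOM N f x0. f y - min_val f = ereal (M * R / sqrt (real N + 1)))"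
proof -
  obtain b :: "nat \<Rightarrow> 'a" where b: "\<And>i. i \<le> N \<Longrightarrow> norm (b i) = 1"
    and bo: "\<And>i j. i \<le> N \<Longrightarrow> j \<le> N \<Longrightarrow> i \<noteq> j \<Longrightarrow> b i \<bullet> b j = 0"
    using obtain_orthonormal_sequence[OF dim] by blast
  define q where "q = sqrt (real N + 1)"
  have q: "q > 0" "q\<^sup>2 = real N + 1" unfolding q_def by auto
  define c where "c = M * R / q"
  have c: "c \<ge> 0" using M R q unfolding c_def by simp
  define \<phi> where "\<phi> = truncated_max M N b c"
  note ge = truncated_max_ge[where c=c and M=M and N=N and b=b, folded \<phi>_def]
  define f where "f = (\<lambda>x. ereal (\<phi> x))"
  define xs where "xs = - ((R / q) *\<^sub>R (\<Sum>j\<le>N. b j))"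
  have "b i \<bullet> (\<Sum>j\<le>N. b j) = 1" if "i \<le> N" for i
  proof -
    have "b i \<bullet> (\<Sum>j\<le>N. b j) = (\<Sum>j\<le>N. if j = i then 1 else 0)"
      unfolding inner_sum_right
      by (rule sum.cong) (use bo b that in \<open>auto simp: dot_square_norm\<close>)
    then show ?thesis using that by simp
  qed
  then have "\<phi> xs \<le> - c"
    unfolding \<phi>_def truncated_max_le_iff by (auto simp: xs_def c_def)
  then have fxs: "\<phi> xs = - c" using ge(1)[of xs] by linarith
  have "(norm (\<Sum>j\<le>N. b j))\<^sup>2 = (\<Sum>j\<le>N. (norm (b j))\<^sup>2)"
    by (intro norm_sum_Pythagorean) (auto simp: pairwise_def orthogonal_def bo)
  also have "\<dots> = q\<^sup>2" using b by (simp add: q(2))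
  finally have "norm (\<Sum>j\<le>N. b j) = q" using q(1) by (simp add: power2_eq_iff_nonneg)
  then have nxs: "norm (0 - xs) \<le> R" using q(1) R by (simp add: xs_def)
  have inp: "is_input M R f 0"
    unfolding is_input_def
  proof (intro conjI exI)
    show "f \<in> class_C M" unfolding f_def \<phi>_def by (rule truncated_max_in_class[OF M b])
    show "is_arg_min f (\<lambda>_. True) xs"
      unfolding is_arg_min_def f_def using ge(1) by (auto simp: fxs not_less)
  qed (rule nxs)
  have "min_val f = f xs" unfolding min_val_def
    by (rule antisym[OF INF_lower INF_greatest]) (simp_all add: f_def fxs ge(1))
  then have mv: "min_val f = ereal (- c)" by (simp add: f_def fxs)
  have "\<phi> 0 \<le> 0" unfolding \<phi>_def truncated_max_le_iff using c by simp
  moreover have "0 \<le> \<phi> 0" using ge(2)[of 0 0] by simp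
  ultimately have phi0: "\<phi> 0 = 0" by simp
  have "gfom_run N f 0 (\<lambda>_. 0) (\<lambda>i. M *\<^sub>R b i)"
    unfolding gfom_run_def
  proof (intro conjI allI impI ballI)
    fix i assume "i \<le> N"
    then show "M *\<^sub>R b i \<in> subdifferential f 0"
      unfolding subdifferential_def f_def using ge(2)[of i] by (simp add: phi0)
  next
    fix i assume i: "i \<in> {1..N}"
    have "0 \<le> \<phi> z" if "z \<in> span ((\<lambda>i. M *\<^sub>R b i) ` {0..<i})" for z
    proof -
      have "orthogonal (b i) z"
        by (rule orthogonal_to_span[OF that]) (use bo i in \<open>auto simp: orthogonal_def\<close>)
      then show ?thesis using ge(2)[of i z] i by (simp add: orthogonal_def)
    qed
    then show "is_arg_min f (\<lambda>z. z \<in> (+) 0 ` span ((\<lambda>i. M *\<^sub>R b i) ` {0..<i})) 0"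
      unfolding is_arg_min_def f_def by (auto simp: phi0 span_zero not_less)
    fix j assume "j < i"
    then show "M *\<^sub>R b i \<bullet> M *\<^sub>R b j = 0" using bo[of i j] i by simp
  qed simp
  then have "0 \<in> GFOM N f 0" unfolding GFOM_def by auto
  moreover have "f 0 - min_val f = ereal (M * R / sqrt (real N + 1))"
    unfolding mv by (simp add: f_def phi0 c_def q_def)
  ultimately show ?thesis using inp by blast
qed

section \<open>Guarantees and tightness for inputs with bounded subgradients\<close>

theorem corollary2:
  fixes M Rx :: real
    and f :: "real ^ 'd \<Rightarrow> ereal"
    and x0 :: "real ^ 'd"
  assumes "M \<ge> 0" and "Rx \<ge> 0"
    and "is_input M Rx f x0"
  shows "(\<forall>N::nat. N \<ge> 1 \<longrightarrow>
            (\<forall>y\<in>GFOM N f x0. f y - min_val f \<le> ereal (M * Rx / sqrt (real N + 1))) \<and>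
            (CARD('d) \<ge> 2 * N + 2 \<longrightarrow>
               (\<forall>\<epsilon>>0. \<exists>(fh :: real ^ 'd \<Rightarrow> ereal) xh. is_input M Rx fh xh \<and>
                  (\<exists>y\<in>GFOM N fh xh.
                     fh y - min_val fh \<ge> ereal (M * Rx / sqrt (real N + 1) - \<epsilon>)))))
       \<and> (M > 0 \<longrightarrow>
           (\<forall>(N::nat) (x :: nat \<Rightarrow> real ^ 'd) (g :: nat \<Rightarrow> real ^ 'd).
              N \<ge> 1 \<and> x 0 = x0 \<and>
              (\<forall>i\<le>N. g i \<in> subdifferential f (x i)) \<and>
              (\<forall>i\<in>{1..N}.
                 g i \<bullet> (x i -
                   ((real i / (real i + 1)) *\<^sub>R x (i - 1)
                    + (1 / (real i + 1)) *\<^sub>R x0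
                    - ((1 / (real i + 1)) * (Rx / (M * sqrt (real N + 1)))) *\<^sub>R (\<Sum>j=0..i-1. g j)))
                 = 0)
              \<longrightarrow> f (x N) - min_val f \<le> ereal (M * Rx / sqrt (real N + 1))))"
proof (intro conjI allI impI ballI)
  fix N :: nat and y assume "y \<in> GFOM N f x0"
  then show "f y - min_val f \<le> ereal (M * Rx / sqrt (real N + 1))"
    by (rule gfom_upper_bound[OF assms(1,3)])
next
  fix N :: nat and \<epsilon> :: real assume "2 * N + 2 \<le> CARD('d)" and \<epsilon>: "0 < \<epsilon>"
  then have "N < DIM(real ^ 'd)" by simp
  from gfom_bound_attained[OF assms(1,2) this]
  obtain fh :: "real ^ 'd \<Rightarrow> ereal" and xh y where
    *: "is_input M Rx fh xh" "y \<in> GFOM N fh xh"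
       "fh y - min_val fh = ereal (M * Rx / sqrt (real N + 1))"
    by blast
  have "ereal (M * Rx / sqrt (real N + 1) - \<epsilon>) \<le> fh y - min_val fh" using *(3) \<epsilon> by simp
  with * show "\<exists>(fh :: real ^ 'd \<Rightarrow> ereal) xh. is_input M Rx fh xh \<and>
      (\<exists>y\<in>GFOM N fh xh. ereal (M * Rx / sqrt (real N + 1) - \<epsilon>) \<le> fh y - min_val fh)" by blast
next
  fix N :: nat and x g :: "nat \<Rightarrow> real ^ 'd"
  assume "M > 0" and run: "N \<ge> 1 \<and> x 0 = x0 \<and>
              (\<forall>i\<le>N. g i \<in> subdifferential f (x i)) \<and>
              (\<forall>i\<in>{1..N}.
                 g i \<bullet> (x i -
                   ((real i / (real i + 1)) *\<^sub>R x (i - 1)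
                    + (1 / (real i + 1)) *\<^sub>R x0
                    - ((1 / (real i + 1)) * (Rx / (M * sqrt (real N + 1)))) *\<^sub>R (\<Sum>j=0..i-1. g j)))
                 = 0)"
  show "f (x N) - min_val f \<le> ereal (M * Rx / sqrt (real N + 1))"
    using averaging_upper_bound[OF \<open>M > 0\<close> assms(2,3)] run by (elim conjE)
qed

end
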